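(* Suppose that $\lambda$ is a limit cardinal, $D$ is an ultrafilter, and there are arbitrarily large $\nu<\lambda$ for which $D$ is $\nu$-decomposable. Then: (a) $D$ is $\kappa$-decomposable for some cardinal $\kappa$ with $\lambda\leq\kappa\leq\lambda^{\operatorname{cf}\lambda}$. (b) In addition, suppose that $\lambda$ is singular and $D$ is $(\mu,\operatorname{cf}\lambda)$-regular, for some infinite cardinal $\mu$. Then $D$ is $\kappa$-decomposable for some cardinal $\kappa$ with $\lambda\leq\kappa\leq\lambda^{<\mu}$. More generally, for every cardinal $\lambda'$ with $\mu\leq\lambda'<\lambda$ there exists a cardinal $\kappa$ such that $D$ is $\kappa$-decomposable and $\lambda\leq\kappa\leq\operatorname{COV}(\lambda,\lambda',\mu)$.
   Context: We work in ZFC. For infinite cardinals $\mu,\lambda$, an ultrafilter $D$ over a set $I$ is $(\mu,\lambda)$-regular if there is an indexed family $(X_\alpha)_{\alpha<\lambda}$ of members of $D$ such that $\bigcap_{\alpha\in A}X_\alpha=\emptyset$ whenever $A\subseteq\lambda$ and $|A|=\mu$. $D$ is $\lambda$-decomposable if there is a function $f:I\to\lambda$ such that $f^{-1}(X)\notin D$ whenever $X\subseteq\lambda$ and $|X|<\lambda$. "There are arbitrarily large $\nu<\lambda$ for which $D$ is $\nu$-decomposable" means that for every cardinal $\nu'<\lambda$ there is $\nu$ with $\nu'<\nu<\lambda$ such that $D$ is $\nu$-decomposable. $\lambda^{<\mu}=\sup\{\lambda^{\mu'}\mid\mu'<\mu\}$. For cardinals $\lambda\geq\lambda'\geq\mu$,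 $\operatorname{COV}(\lambda,\lambda',\mu)$ is the minimal cardinality of a family of subsets of $\lambda$, each of cardinality $<\lambda'$, such that every subset of $\lambda$ of cardinality $<\mu$ is contained in at least one member of the family. *)

theory Defs
  imports Main
begin

unbundle cardinal_syntax

text \<open>
  Cardinals are represented as in the library: a cardinal is a relation satisfying
  \<^const>\<open>Card_order\<close>, compared across types by \<open><o\<close>, \<open>\<le>o\<close>, \<open>=o\<close>; the elements of the cardinal,
  viewed as a set of ordinals, are the elements of its \<^const>\<open>Field\<close>.
\<close>

subsection \<open>Cardinals\<close>

definition least_card :: "'a rel set \<Rightarrow> 'a rel" where
  "least_card C = (SOME r. r \<in> C \<and> (\<forall>s\<in>C. r \<le>o s))"

text \<open>
  Upper bounds exist: every cardinal on the type \<open>'a\<close> is at most \<open>|UNIV :: 'a set|\<close>. Any upper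
  bound living on another type is at least the one chosen here.
\<close>

definition sup_card :: "'a rel set \<Rightarrow> 'a rel" where
  "sup_card C = least_card {r. Card_order r \<and> (\<forall>s\<in>C. s \<le>o r)}"

definition limit_cardinal :: "'a rel \<Rightarrow> bool" where
  "limit_cardinal r \<longleftrightarrow>
    Cinfinite r \<and> \<not> (\<exists>s :: 'a rel. Card_order s \<and> r =o cardSuc s)"

text \<open>
  Used for infinite cardinals only, where \<^const>\<open>cofinal\<close> (strictly unbounded) is the usual notion.
\<close>

definition cf :: "'a rel \<Rightarrow> 'a rel" where
  "cf r = least_card {|A| | A. A \<subseteq> Field r \<and> cofinal A r}"

text \<open>The supremum of the powers of \<open>r\<close> with exponents below \<open>m\<close>.\<close>

definition cexp_less :: "'a rel \<Rightarrow> 'm rel \<Rightarrow> ('m \<Rightarrow> 'a) rel" where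
  "cexp_less r m = sup_card {r ^c n | n :: 'm rel. Card_order n \<and> n <o m}"

text \<open>Meaningful for \<open>m \<le>o l\<close> and \<open>l \<le>o r\<close>, when such families exist.\<close>

definition COV :: "'a rel \<Rightarrow> 'l rel \<Rightarrow> 'm rel \<Rightarrow> 'a set rel" where
  "COV r l m = least_card {|F| | F.
     (\<forall>Y\<in>F. Y \<subseteq> Field r \<and> |Y| <o l) \<and>
     (\<forall>Z. Z \<subseteq> Field r \<and> |Z| <o m \<longrightarrow> (\<exists>Y\<in>F. Z \<subseteq> Y))}"

subsection \<open>Ultrafilters\<close>

text \<open>
  An ultrafilter over the set \<open>I\<close> is a library filter concentrated on \<open>I\<close>; a subset \<open>X\<close> of \<open>I\<close> is a
  member of it iff \<open>eventually (\<lambda>i. i \<in> X) D\<close>.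
\<close>

definition ultrafilter_on :: "'i set \<Rightarrow> 'i filter \<Rightarrow> bool" where
  "ultrafilter_on I D \<longleftrightarrow>
    D \<noteq> bot \<and> D \<le> principal I \<and> (\<forall>P. eventually P D \<or> eventually (\<lambda>i. \<not> P i) D)"

definition regular_filter :: "'i set \<Rightarrow> 'i filter \<Rightarrow> 'm rel \<Rightarrow> 'a rel \<Rightarrow> bool" where
  "regular_filter I D m r \<longleftrightarrow> Cinfinite m \<and> Cinfinite r \<and>
    (\<exists>X :: 'a \<Rightarrow> 'i set.
       (\<forall>a\<in>Field r. X a \<subseteq> I \<and> eventually (\<lambda>i. i \<in> X a) D) \<and>
       (\<forall>A. A \<subseteq> Field r \<and> |A| =o m \<longrightarrow> (\<Inter>a\<in>A. X a) = {}))"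

definition decomposable :: "'i set \<Rightarrow> 'i filter \<Rightarrow> 'a rel \<Rightarrow> bool" where
  "decomposable I D r \<longleftrightarrow> Cinfinite r \<and>
    (\<exists>f :: 'i \<Rightarrow> 'a. f ` I \<subseteq> Field r \<and>
       (\<forall>X. X \<subseteq> Field r \<and> |X| <o r \<longrightarrow> \<not> eventually (\<lambda>i. i \<in> I \<and> f i \<in> X) D))"

end

theory Submission
  imports Defs
begin

text \<open>
  Fix a set \<open>A\<close> cofinal in \<open>\<Lambda>\<close> of size \<open>cf \<Lambda>\<close> and, for \<open>a \<in> A\<close>, a function \<open>f a\<close> into \<open>\<Lambda>\<close>
  witnessing decomposability for some cardinal above \<open>|a|\<close>. Suppose that one function \<open>g\<close> on \<open>I\<close>
  determines all the \<open>f a\<close>, in the weak sense that a set \<open>W\<close> with \<open>g i \<in> W\<close> almost everywhere yields,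
  for each \<open>a\<close>, a set of size about \<open>|W|\<close> containing \<open>f a i\<close> almost everywhere. Then every such \<open>W\<close>
  has size at least \<open>\<Lambda>\<close>, and one of least cardinality \<open>\<kappa>\<close> gives \<open>\<kappa>\<close>-decomposability. For (a) let
  \<open>g i\<close> be the sequence \<open>(f a i)\<^sub>a\<close>. For (b) regularity makes the set of those \<open>a\<close> with \<open>i \<in> X a\<close>
  smaller than \<open>\<mu>\<close>, so the pairs \<open>(a, f a i)\<close> with \<open>i \<in> X a\<close> form a small subset of a copy of \<open>\<Lambda>\<close>,
  and \<open>g i\<close> is a member of the covering family containing it. For the bound \<open>\<Lambda>\<close> to the power \<open><\<mu>\<close>,
  cover by all subsets of size below \<open>\<mu>\<close> if \<open>\<mu> \<le> cf \<Lambda>\<close>; otherwise it follows from (a).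
\<close>

section \<open>Minima and suprema of cardinals, powers and covering numbers\<close>

lemma Card_order_not_less:
  assumes "Card_order r" "Card_order s" "\<not> r <o s"
  shows "s \<le>o r"
  using assms not_ordLess_iff_ordLeq[of s r] by (simp add: card_order_on_well_order_on)

lemma least_card_least:
  assumes "r0 \<in> C" "\<And>r. r \<in> C \<Longrightarrow> Card_order r"
  shows "least_card C \<in> C \<and> (\<forall>s\<in>C. least_card C \<le>o s)"
proof -
  have "C \<noteq> {}" using assms(1) by (rule ex_in_conv[THEN iffD1, OF exI])
  then have "\<exists>r. r \<in> C \<and> (\<forall>s\<in>C. r \<le>o s)"
    using exists_minim_Card_order[of C] assms(2) by (simp add: Bex_def)
  then show ?thesis unfolding least_card_def by (rule someI_ex)
qed

text \<open>\<open>cf\<close> and \<open>COV\<close> are both least sizes of sets with some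
  property; this supplies a set with the property that attains the minimum.\<close>

lemma least_card_of:
  assumes "P A0"
  shows "\<exists>A. least_card {|A| | A. P A} = |A| \<and> P A \<and> (\<forall>B. P B \<longrightarrow> |A| \<le>o |B| )"
proof -
  let ?C = "{|A| | A. P A}"
  have mem: "|B| \<in> ?C" if "P B" for B using that by auto
  have least: "least_card ?C \<in> ?C" "\<forall>s\<in>?C. least_card ?C \<le>o s"
    using least_card_least[OF mem[OF assms]] card_of_Card_order by auto
  from least(1) obtain A where A: "least_card ?C = |A|" "P A" by auto
  have "|A| \<le>o |B|" if "P B" for B using bspec[OF least(2) mem[OF that]] unfolding A(1) .
  with A show ?thesis by blast
qed

lemma cf_eq_card_of:
  assumes "Cinfinite r"
  obtains A where "cf r = |A|" "A \<subseteq> Field r" "cofinal A r"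
proof -
  have "cofinal (Field r) r"
    unfolding cofinal_def using infinite_Card_order_limit[of r] assms by (auto simp: cinfinite_def)
  then show thesis
    using least_card_of[of "\<lambda>A. A \<subseteq> Field r \<and> cofinal A r" "Field r"] that unfolding cf_def by blast
qed

lemma cf_le_cofinal:
  assumes "A \<subseteq> Field r" "cofinal A r"
  shows "cf r \<le>o |A|"
  using least_card_of[of "\<lambda>A. A \<subseteq> Field r \<and> cofinal A r" A] assms ordIso_ordLeq_trans
  unfolding cf_def by auto

lemma singular_cf_less:
  assumes "Cinfinite r" "\<not> regularCard r"
  shows "cf r <o r"
proof -
  obtain K where K: "K \<subseteq> Field r" "cofinal K r" "\<not> |K| =o r"
    using assms(2) unfolding regularCard_def by blast
  have "|K| \<le>o r"
    using card_of_mono1[OF K(1)] card_of_Field_ordIso assms(1) ordLeq_ordIso_trans by blast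
  then have "|K| <o r" using K(3) ordLeq_iff_ordLess_or_ordIso by blast
  then show ?thesis using cf_le_cofinal[OF K(1,2)] ordLeq_ordLess_trans by blast
qed

lemma sup_card_upper:
  fixes C :: "'b rel set"
  assumes "\<And>s. s \<in> C \<Longrightarrow> Card_order s"
  shows "Card_order (sup_card C) \<and> (\<forall>s\<in>C. s \<le>o sup_card C)"
proof -
  let ?U = "{r. Card_order r \<and> (\<forall>s\<in>C. s \<le>o r)}"
  have "s \<le>o |UNIV :: 'b set|" if "s \<in> C" for s
    using assms[OF that] card_of_Field_ordIso ordIso_symmetric card_of_mono1[of "Field s" UNIV]
      ordIso_ordLeq_trans by blast
  then have "|UNIV :: 'b set| \<in> ?U" using card_of_Card_order by auto
  then have "sup_card C \<in> ?U" unfolding sup_card_def using least_card_least[of _ ?U] by auto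
  then show ?thesis by simp
qed

text \<open>The exponent \<open>n\<close> may live on a type other than that of \<open>m\<close>.
  Being smaller than \<open>m\<close>, it has a copy \<open>|B|\<close> on that type, which is among
  the exponents of the supremum.\<close>

lemma cexp_le_cexp_less:
  fixes r :: "'a rel" and m :: "'m rel"
  assumes "Card_order r" "Card_order n" "n <o m"
  shows "r ^c n \<le>o cexp_less r m"
proof -
  obtain B :: "'m set" where B: "n =o |B|" "|B| <o m"
    using assms(2,3) internalize_card_of_ordLess[of "Field n" m] card_of_Field_ordIso
    by (meson ordIso_ordLess_trans ordIso_symmetric ordIso_transitive)
  let ?C = "{r ^c n | n :: 'm rel. Card_order n \<and> n <o m}"
  have "r ^c |B| \<in> ?C" using B(2) card_of_Card_order by blast
  then have "r ^c |B| \<le>o cexp_less r m"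
    unfolding cexp_less_def using sup_card_upper[of ?C] Card_order_cexp by blast
  then show ?thesis using cexp_cong2[OF B(1) assms(1,2)] ordIso_ordLeq_trans by blast
qed

text \<open>Since \<open>m \<le>o l\<close>, all subsets of size below \<open>m\<close> together
  form an admissible family, so the minimum is attained.\<close>

lemma COV_eq_card_of:
  assumes "m \<le>o l"
  obtains F where "COV r l m = |F|" "\<And>Y. Y \<in> F \<Longrightarrow> Y \<subseteq> Field r \<and> |Y| <o l"
    "\<And>Z. Z \<subseteq> Field r \<Longrightarrow> |Z| <o m \<Longrightarrow> \<exists>Y\<in>F. Z \<subseteq> Y"
proof -
  let ?P = "\<lambda>F. (\<forall>Y\<in>F. Y \<subseteq> Field r \<and> |Y| <o l) \<and>
     (\<forall>Z. Z \<subseteq> Field r \<and> |Z| <o m \<longrightarrow> (\<exists>Y\<in>F. Z \<subseteq> Y))"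
  have "?P {Z. Z \<subseteq> Field r \<and> |Z| <o m}"
    using assms ordLess_ordLeq_trans by blast
  from least_card_of[of ?P, OF this]
  obtain F where "least_card {|F| | F. ?P F} = |F| \<and> ?P F \<and> (\<forall>G. ?P G \<longrightarrow> |F| \<le>o |G| )" ..
  then show thesis using that[of F] unfolding COV_def by simp
qed

text \<open>A set of size below \<open>m\<close> is the range of a function on a proper initial
  segment of \<open>m\<close>. There are at most \<open>m \<le>o r\<close> such segments, and for
  each of them the number of functions is a power of \<open>r\<close> below the supremum.\<close>

lemma card_of_small_subsets:
  fixes r :: "'a rel" and m :: "'m rel"
  assumes r: "Cinfinite r" and m: "Cinfinite m" "m \<le>o r"
  shows "|{Z. Z \<subseteq> Field r \<and> |Z| <o m}| \<le>o cexp_less r m"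
proof -
  let ?t = "cexp_less r m"
  let ?S = "SIGMA x : Field m. Func (underS m x) (Field r)"
  have "Card_order ?t"
    using sup_card_upper[of "{r ^c n | n :: 'm rel. Card_order n \<and> n <o m}"] Card_order_cexp
    unfolding cexp_less_def by blast
  moreover obtain x0 where x0: "x0 \<in> Field m" using m(1) unfolding cinfinite_def by fastforce
  have r_le: "r \<le>o ?t"
  proof -
    \<comment> \<open>The singleton plays the exponent 1 on the type of \<open>m\<close>. This gives
      \<open>r \<le>o ?t\<close>, so \<open>?t\<close> is infinite and absorbs the sum over
      segments.\<close>
    have "finite (Field |{x0}| )" by (simp add: Field_card_of)
    then have "|{x0}| <o m"
      using m(1) finite_ordLess_infinite[of "|{x0}|" m] card_of_Well_order
      by (auto simp: cinfinite_def card_order_on_def)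
    then have "r ^c |{x0}| \<le>o ?t" using r cexp_le_cexp_less card_of_Card_order by blast
    moreover have "r \<le>o r ^c |{x0}|"
      using r by (intro ordLeq_cexp1) (auto simp: card_of_Card_order card_of_ordIso_czero_iff_empty)
    ultimately show ?thesis using ordLeq_transitive by blast
  qed
  ultimately have t: "Cinfinite ?t" using r cinfinite_mono by blast
  have "|?S| \<le>o ?t"
  proof (rule card_of_Sigma_ordLeq_infinite_Field)
    show "|Field m| \<le>o ?t"
      using m r_le card_of_Field_ordIso ordIso_ordLeq_trans ordLeq_transitive by blast
    show "\<forall>x\<in>Field m. |Func (underS m x) (Field r)| \<le>o ?t"
    proof
      fix x assume "x \<in> Field m"
      then have "|underS m x| <o m" using m(1) by (intro card_of_underS) auto
      then have "r ^c |underS m x| \<le>o ?t" using r by (intro cexp_le_cexp_less card_of_Card_order) auto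
      then show "|Func (underS m x) (Field r)| \<le>o ?t" by (simp add: cexp_def Field_card_of)
    qed
  qed (use t in \<open>auto simp: cinfinite_def\<close>)
  moreover have "{Z. Z \<subseteq> Field r \<and> |Z| <o m} \<subseteq> (\<lambda>(x, h). h ` underS m x) ` ?S"
  proof clarify
    fix Z assume Z: "Z \<subseteq> Field r" "|Z| <o m"
    then obtain x where x: "x \<in> Field m" "|Z| =o Restr m (underS m x)"
      using iffD1[OF ordLess_iff_ordIso_Restr[OF _ card_of_Well_order] Z(2)] m(1)
        card_order_on_well_order_on by blast
    have "Refl m" using m(1) by (simp add: card_order_on_def order_on_defs)
    then have "Field (Restr m (underS m x)) = underS m x"
      by (rule Refl_Field_Restr2) (auto simp: underS_def Field_def)
    then have "|Z| =o |underS m x|" using card_of_cong[OF x(2)] by (simp add: Field_card_of)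
    then have "|underS m x| =o |Z|" by (rule ordIso_symmetric)
    then obtain h where h: "bij_betw h (underS m x) Z" using card_of_ordIso by blast
    \<comment> \<open>Members of \<open>Func\<close> take the value \<open>undefined\<close> off
      their domain.\<close>
    define h' where "h' = (\<lambda>y. if y \<in> underS m x then h y else undefined)"
    have "h' \<in> Func (underS m x) (Field r)" "h' ` underS m x = Z"
      using h Z(1) by (auto simp: h'_def Func_def bij_betw_def)
    then show "Z \<in> (\<lambda>(x, h). h ` underS m x) ` ?S" using x(1) by force
  qed
  then have "|{Z. Z \<subseteq> Field r \<and> |Z| <o m}| \<le>o |?S|" by (rule surj_imp_ordLeq)
  ultimately show ?thesis using ordLeq_transitive by blast
qed

section \<open>Criteria for decomposability\<close>

text \<open>If \<open>s <o r\<close>, then \<open>s\<close> is isomorphic to the segment below some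
  \<open>b\<close>. An element \<open>a\<close> of \<open>A\<close> above \<open>b\<close> then has
  at least \<open>s\<close> predecessors, against \<open>less\<close>.\<close>

lemma cofinal_bound:
  assumes r: "Card_order r" and A: "cofinal A r" and s: "Card_order s"
    and less: "\<And>a. a \<in> A \<Longrightarrow> |underS r a| <o s"
  shows "r \<le>o s"
proof (rule ccontr)
  assume "\<not> r \<le>o s"
  then obtain b where b: "b \<in> Field r" "s =o Restr r (underS r b)"
    using r s ordLess_iff_ordIso_Restr not_ordLeq_iff_ordLess by (metis card_order_on_well_order_on)
  obtain a where a: "a \<in> A" "b \<noteq> a" "(b, a) \<in> r" using A b(1) unfolding cofinal_def by blast
  have tr: "trans r" "antisym r"
    using r by (auto simp: card_order_on_def order_on_defs)
  have "underS r b \<subseteq> underS r a"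
    using a tr by (auto simp: underS_def dest: transD antisymD)
  moreover have "Field (Restr r (underS r b)) \<subseteq> underS r b" by (auto simp: Field_def)
  ultimately have "|Field (Restr r (underS r b))| \<le>o |underS r a|"
    using card_of_mono1 by (metis subset_trans)
  moreover have "s =o |Field (Restr r (underS r b))|"
    using card_of_cong[OF b(2)] s card_of_Field_ordIso ordIso_symmetric ordIso_transitive by blast
  ultimately have "s \<le>o |underS r a|" using ordIso_ordLeq_trans by blast
  then show False using less[OF a(1)] not_ordLess_ordLeq by blast
qed

text \<open>Let \<open>W\<close> have least cardinality among the subsets of \<open>B\<close>
  containing \<open>g i\<close> almost everywhere. Then \<open>g\<close>, corrected where it leaves
  \<open>W\<close>, witnesses decomposability for \<open>|W|\<close>: a smaller set containing its
  values almost everywhere would contradict minimality.\<close>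

lemma decomposable_of_large_images:
  fixes g :: "'i \<Rightarrow> 'b" and B :: "'b set"
  assumes D: "D \<le> principal I" and g: "g ` I \<subseteq> B" and r: "Cinfinite r"
    and large: "\<And>W. W \<subseteq> B \<Longrightarrow> eventually (\<lambda>i. i \<in> I \<and> g i \<in> W) D \<Longrightarrow> r \<le>o |W|"
  shows "\<exists>\<kappa> :: 'b rel. decomposable I D \<kappa> \<and> r \<le>o \<kappa> \<and> \<kappa> \<le>o |B|"
proof -
  have "eventually (\<lambda>i. i \<in> I) D" using D by (simp add: le_principal)
  then have ev: "eventually (\<lambda>i. i \<in> I \<and> g i \<in> B) D" by eventually_elim (use g in auto)
  let ?P = "\<lambda>W. W \<subseteq> B \<and> eventually (\<lambda>i. i \<in> I \<and> g i \<in> W) D"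
  from least_card_of[of ?P, OF conjI[OF order_refl ev]]
  obtain W where "least_card {|W| | W. ?P W} = |W| \<and> ?P W \<and> (\<forall>X. ?P X \<longrightarrow> |W| \<le>o |X| )" ..
  then have W: "W \<subseteq> B" "eventually (\<lambda>i. i \<in> I \<and> g i \<in> W) D"
    and least: "\<And>X. X \<subseteq> B \<Longrightarrow> eventually (\<lambda>i. i \<in> I \<and> g i \<in> X) D \<Longrightarrow> |W| \<le>o |X|"
    by simp_all
  have "r \<le>o |W|" using large W by blast
  then have W_inf: "Cinfinite |W|" using r cinfinite_mono card_of_Card_order by blast
  then have "W \<noteq> {}" by (auto simp: cinfinite_def Field_card_of)
  then obtain w where w: "w \<in> W" by blast
  define f where "f i = (if g i \<in> W then g i else w)" for i
  have "\<not> eventually (\<lambda>i. i \<in> I \<and> f i \<in> X) D" if X: "X \<subseteq> W" "|X| <o |W|" for X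
  proof
    assume "eventually (\<lambda>i. i \<in> I \<and> f i \<in> X) D"
    with W(2) have "eventually (\<lambda>i. i \<in> I \<and> g i \<in> X) D"
      by eventually_elim (auto simp: f_def)
    then have "|W| \<le>o |X|" using least W(1) X(1) by blast
    then show False using X(2) not_ordLess_ordLeq by blast
  qed
  moreover have "f ` I \<subseteq> W" using w by (auto simp: f_def)
  ultimately have "decomposable I D |W|"
    unfolding decomposable_def using W_inf
    by (intro conjI exI[of _ f]) (auto simp: Field_card_of)
  then show ?thesis using \<open>r \<le>o |W|\<close> card_of_mono1[OF W(1)] by blast
qed

text \<open>A cardinal found on one type must sometimes be moved to the type prescribed by a bound
  \<open>s\<close>. An injection \<open>e\<close> into \<open>Field s\<close> does this: composing
  the witness with \<open>e\<close> works because preimages under \<open>e\<close> of small sets are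
  small.\<close>

lemma decomposable_transfer:
  fixes r :: "'a rel" and s :: "'b rel"
  assumes r: "decomposable I D r" and l: "l \<le>o r" and le: "r \<le>o s"
  shows "\<exists>r' :: 'b rel. decomposable I D r' \<and> l \<le>o r' \<and> r' \<le>o s"
proof -
  have co: "Cinfinite r" using r unfolding decomposable_def by blast
  obtain f where f: "f ` I \<subseteq> Field r"
    "\<And>X. X \<subseteq> Field r \<Longrightarrow> |X| <o r \<Longrightarrow> \<not> eventually (\<lambda>i. i \<in> I \<and> f i \<in> X) D"
    using r unfolding decomposable_def by meson
  obtain e where e: "inj_on e (Field r)" "e ` Field r \<subseteq> Field s"
    using iffD2[OF card_of_ordLeq card_of_mono2[OF le]] by blast
  let ?r' = "|e ` Field r|"
  have iso: "?r' =o r"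
    using e(1) co card_of_ordIso card_of_Field_ordIso ordIso_symmetric ordIso_transitive
    by (meson inj_on_imp_bij_betw)
  have "\<not> eventually (\<lambda>i. i \<in> I \<and> (e \<circ> f) i \<in> X) D"
    if X: "X \<subseteq> e ` Field r" "|X| <o ?r'" for X
  proof
    assume ev: "eventually (\<lambda>i. i \<in> I \<and> (e \<circ> f) i \<in> X) D"
    let ?X = "{x \<in> Field r. e x \<in> X}"
    have "|?X| \<le>o |X|" using e(1) by (intro card_of_ordLeqI[of e]) (auto intro: inj_on_subset)
    then have "|?X| <o r" using X(2) iso ordLeq_ordLess_trans ordLess_ordIso_trans by blast
    moreover have "eventually (\<lambda>i. i \<in> I \<and> f i \<in> ?X) D"
      using ev f(1) by (auto elim!: eventually_mono)
    ultimately show False using f(2)[of ?X] by blast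
  qed
  moreover have "Cinfinite ?r'"
    using co iso by (meson Cinfinite_cong ordIso_symmetric)
  moreover have "(e \<circ> f) ` I \<subseteq> e ` Field r" using f(1) by auto
  ultimately have "decomposable I D ?r'"
    unfolding decomposable_def Field_card_of by blast
  moreover have "l \<le>o ?r'" using l iso ordIso_symmetric ordLeq_ordIso_trans by blast
  moreover have "?r' \<le>o s" using le iso ordIso_ordLeq_trans by blast
  ultimately show ?thesis by blast
qed

section \<open>Combining cofinally many decompositions\<close>

text \<open>All \<open>f a\<close> take values in the one set \<open>Field \<Lambda>\<close>, so
  that they can be packed into a single function. What remains of decomposability above
  \<open>|underS \<Lambda> a|\<close>, the cardinality of the ordinal \<open>a\<close>, is
  \<open>f_large\<close>.\<close>

locale cofinal_decompositions =
  fixes I :: "'i set" and D :: "'i filter" and \<Lambda> :: "'a rel" and A :: "'a set"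
    and f :: "'a \<Rightarrow> 'i \<Rightarrow> 'a"
  assumes concentrated: "D \<le> principal I"
    and infinite: "Cinfinite \<Lambda>"
    and A_sub: "A \<subseteq> Field \<Lambda>" and A_cofinal: "cofinal A \<Lambda>"
    and f_range: "\<And>a i. a \<in> A \<Longrightarrow> i \<in> I \<Longrightarrow> f a i \<in> Field \<Lambda>"
    and f_large: "\<And>a X. a \<in> A \<Longrightarrow> eventually (\<lambda>i. i \<in> I \<and> f a i \<in> X) D \<Longrightarrow> |underS \<Lambda> a| <o |X|"
begin

text \<open>Evaluation at \<open>a\<close> maps a set \<open>W\<close> of sequences onto a set no
  larger than \<open>W\<close> that contains \<open>f a i\<close> almost everywhere, so
  \<open>f_large\<close> and \<open>cofinal_bound\<close> apply.\<close>

lemma decomposable_power: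
  "\<exists>\<kappa> :: ('a \<Rightarrow> 'a) rel. decomposable I D \<kappa> \<and> \<Lambda> \<le>o \<kappa> \<and> \<kappa> \<le>o |Func A (Field \<Lambda>)|"
proof (rule decomposable_of_large_images[OF concentrated])
  let ?g = "\<lambda>i a. if a \<in> A then f a i else undefined"
  show "?g ` I \<subseteq> Func A (Field \<Lambda>)" using f_range by (auto simp: Func_def)
  fix W assume W: "eventually (\<lambda>i. i \<in> I \<and> ?g i \<in> W) D"
  have "|underS \<Lambda> a| <o |W|" if a: "a \<in> A" for a
  proof -
    have "eventually (\<lambda>i. i \<in> I \<and> f a i \<in> (\<lambda>h. h a) ` W) D"
      using W
    proof eventually_elim
      case (elim i)
      then show ?case using a by (intro conjI image_eqI[of _ _ "?g i"]) auto
    qed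
    then show ?thesis using f_large[OF a] card_of_image ordLess_ordLeq_trans by blast
  qed
  then show "\<Lambda> \<le>o |W|"
    using cofinal_bound A_cofinal infinite card_of_Card_order by blast
qed (rule infinite)

text \<open>A subfamily \<open>W\<close> of the cover recovers \<open>f a i\<close> only up to a
  union of \<open>|W|\<close> sets of size at most \<open>l\<close>. If
  \<open>|W| <o \<Lambda>\<close>, the sum of \<open>|W|\<close> and \<open>l\<close> is still below
  \<open>\<Lambda>\<close> and bounds all these unions, contradicting
  \<open>cofinal_bound\<close>.\<close>

lemma decomposable_cover:
  fixes m :: "'m rel" and l :: "'l rel" and F :: "'a set set"
  assumes reg: "regular_filter I D m |A|" and l: "Cinfinite l" "l <o \<Lambda>"
    and F: "\<And>Y. Y \<in> F \<Longrightarrow> |Y| <o l"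
      "\<And>Z. Z \<subseteq> Field \<Lambda> \<Longrightarrow> |Z| <o m \<Longrightarrow> \<exists>Y\<in>F. Z \<subseteq> Y"
  shows "\<exists>\<kappa> :: 'a set rel. decomposable I D \<kappa> \<and> \<Lambda> \<le>o \<kappa> \<and> \<kappa> \<le>o |F|"
proof -
  obtain X where X: "\<And>a. a \<in> A \<Longrightarrow> eventually (\<lambda>i. i \<in> X a) D"
    "\<And>S. S \<subseteq> A \<Longrightarrow> |S| =o m \<Longrightarrow> (\<Inter>a\<in>S. X a) = {}"
    using reg unfolding regular_filter_def Field_card_of by meson
  have m: "Cinfinite m" using reg unfolding regular_filter_def by blast
  define S where "S i = {a \<in> A. i \<in> X a}" for i
  have S: "|S i| <o m" for i
  \<comment> \<open>Otherwise \<open>S i\<close> has a subset \<open>T\<close> of size exactly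
    \<open>m\<close>. Regularity makes the corresponding sets \<open>X a\<close> disjoint as a
    family, yet \<open>i\<close> lies in all of them.\<close>
  proof (rule ccontr)
    assume "\<not> |S i| <o m"
    then have "m \<le>o |S i|" using m card_of_Card_order Card_order_not_less by blast
    then have "|Field m| \<le>o |S i|"
      using m card_of_Field_ordIso ordIso_ordLeq_trans by blast
    from iffD1[OF internalize_card_of_ordLeq2 this]
    obtain T where T: "T \<subseteq> S i" "|Field m| =o |T|" by blast
    then have "|T| =o m"
      using m card_of_Field_ordIso ordIso_symmetric ordIso_transitive by blast
    then have "(\<Inter>a\<in>T. X a) = {}" using X(2) T(1) by (auto simp: S_def)
    moreover have "i \<in> (\<Inter>a\<in>T. X a)" using T(1) by (auto simp: S_def)
    ultimately show False by blast
  qed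
  have "|Field \<Lambda> \<times> Field \<Lambda>| \<le>o |Field \<Lambda>|"
    using infinite card_of_Times_same_infinite ordIso_imp_ordLeq unfolding cinfinite_def by blast
  then obtain c where c: "inj_on c (Field \<Lambda> \<times> Field \<Lambda>)" "c ` (Field \<Lambda> \<times> Field \<Lambda>) \<subseteq> Field \<Lambda>"
    using iffD2[OF card_of_ordLeq] by blast
  \<comment> \<open>The pairing \<open>c\<close> codes the index \<open>a\<close> with the value
    \<open>f a i\<close>, so the value at a given \<open>a\<close> can be read off from a section of
    a covering set.\<close>
  define G where "G i = (\<lambda>a. c (a, f a i)) ` S i" for i
  have "\<exists>Y\<in>F. G i \<subseteq> Y" if "i \<in> I" for i
  proof (rule F(2))
    show "G i \<subseteq> Field \<Lambda>"
      using that A_sub f_range by (auto simp: G_def S_def intro!: subsetD[OF c(2) imageI])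
    show "|G i| <o m" unfolding G_def using card_of_image S ordLeq_ordLess_trans by blast
  qed
  then obtain y where y: "\<And>i. i \<in> I \<Longrightarrow> y i \<in> F \<and> G i \<subseteq> y i" by metis
  show ?thesis
  proof (rule decomposable_of_large_images[OF concentrated _ infinite])
    show "y ` I \<subseteq> F" using y by blast
    fix W assume W: "W \<subseteq> F" "eventually (\<lambda>i. i \<in> I \<and> y i \<in> W) D"
    \<comment> \<open>The section of \<open>Y\<close> at \<open>a\<close>; injectivity of
      \<open>c\<close> keeps it no larger than \<open>Y\<close>.\<close>
    define P where "P a Y = {x \<in> Field \<Lambda>. c (a, x) \<in> Y}" for a Y
    have bound: "|underS \<Lambda> a| <o |\<Union>Y\<in>W. P a Y|" if a: "a \<in> A" for a
    proof (rule f_large[OF a])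
      show "eventually (\<lambda>i. i \<in> I \<and> f a i \<in> (\<Union>Y\<in>W. P a Y)) D"
        using W(2) X(1)[OF a]
      proof eventually_elim
        case (elim i)
        then have "c (a, f a i) \<in> y i" using y[of i] a by (auto simp: G_def S_def)
        then show ?case using elim f_range[OF a] by (auto simp: P_def)
      qed
    qed
    have P: "|P a Y| \<le>o l" if "a \<in> A" "Y \<in> W" for a Y
    proof -
      have "|P a Y| \<le>o |Y|"
        using that A_sub c(1)
        by (intro card_of_ordLeqI[of "\<lambda>x. c (a, x)"]) (auto simp: P_def inj_on_def)
      then show ?thesis
        using F(1) W(1) that(2) ordLeq_transitive ordLess_imp_ordLeq by blast
    qed
    show "\<Lambda> \<le>o |W|"
    proof (rule ccontr)
      assume "\<not> \<Lambda> \<le>o |W|"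
      then have W_less: "|W| <o \<Lambda>"
        using infinite card_of_Card_order Card_order_not_less by blast
      let ?s = "|W <+> Field l|"
      have "|Field l| <o \<Lambda>" using l card_of_Field_ordIso ordIso_ordLess_trans by blast
      then have s_less: "?s <o \<Lambda>"
        using infinite W_less card_of_Plus_ordLess_infinite_Field unfolding cinfinite_def by blast
      have l_le: "l \<le>o ?s" using l(1) by (intro Card_order_Plus2) blast
      then have s_inf: "\<not> finite (W <+> Field l)"
        using l(1) cinfinite_mono[of l ?s] by (auto simp: cinfinite_def)
      have "|underS \<Lambda> a| <o ?s" if a: "a \<in> A" for a
      proof -
        have "|\<Union>Y\<in>W. P a Y| \<le>o ?s"
          using s_inf card_of_Plus1 P[OF a] l_le ordLeq_transitive
          by (intro card_of_UNION_ordLeq_infinite) blast+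
        then show ?thesis using bound[OF a] ordLess_ordLeq_trans by blast
      qed
      then have "\<Lambda> \<le>o ?s"
        using cofinal_bound A_cofinal infinite card_of_Card_order by blast
      then show False using s_less not_ordLess_ordLeq by blast
    qed
  qed
qed

end

section \<open>Choice of the decompositions and the final bounds\<close>

text \<open>For each \<open>a\<close>, take a witness \<open>h\<close> for some \<open>\<nu>\<close>
  strictly between \<open>|underS \<Lambda> a|\<close> and \<open>\<Lambda>\<close> and compose it
  with an injection of \<open>\<nu>\<close> into \<open>\<Lambda>\<close>. A set containing the
  values almost everywhere has a preimage of size at least \<open>\<nu>\<close>.\<close>

lemma cofinal_decompositions_exist:
  fixes \<Lambda> :: "'a rel"
  assumes D: "D \<le> principal I" and \<Lambda>: "Cinfinite \<Lambda>" and A: "A \<subseteq> Field \<Lambda>" "cofinal A \<Lambda>"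
    and dec: "\<And>\<nu>' :: 'a rel. Card_order \<nu>' \<Longrightarrow> \<nu>' <o \<Lambda> \<Longrightarrow>
           \<exists>\<nu> :: 'a rel. \<nu>' <o \<nu> \<and> \<nu> <o \<Lambda> \<and> decomposable I D \<nu>"
  obtains f where "cofinal_decompositions I D \<Lambda> A f"
proof -
  have "\<exists>h. h ` I \<subseteq> Field \<Lambda> \<and>
      (\<forall>X. eventually (\<lambda>i. i \<in> I \<and> h i \<in> X) D \<longrightarrow> |underS \<Lambda> a| <o |X| )" if a: "a \<in> A" for a
  proof -
    have "|underS \<Lambda> a| <o \<Lambda>" by (rule card_of_underS) (use \<Lambda> a A(1) in auto)
    then obtain \<nu> :: "'a rel" where \<nu>: "|underS \<Lambda> a| <o \<nu>" "\<nu> <o \<Lambda>" "decomposable I D \<nu>"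
      using dec card_of_Card_order by blast
    then obtain h where h: "h ` I \<subseteq> Field \<nu>"
      "\<And>X. X \<subseteq> Field \<nu> \<Longrightarrow> |X| <o \<nu> \<Longrightarrow> \<not> eventually (\<lambda>i. i \<in> I \<and> h i \<in> X) D"
      unfolding decomposable_def by meson
    have co: "Card_order \<nu>" using \<nu>(3) unfolding decomposable_def by blast
    obtain e where e: "inj_on e (Field \<nu>)" "e ` Field \<nu> \<subseteq> Field \<Lambda>"
      using iffD2[OF card_of_ordLeq card_of_mono2[OF ordLess_imp_ordLeq[OF \<nu>(2)]]] by blast
    have "|underS \<Lambda> a| <o |X|" if X: "eventually (\<lambda>i. i \<in> I \<and> (e \<circ> h) i \<in> X) D" for X
    proof -
      let ?X = "{x \<in> Field \<nu>. e x \<in> X}"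
      have "eventually (\<lambda>i. i \<in> I \<and> h i \<in> ?X) D"
        using X h(1) by (auto elim!: eventually_mono)
      then have "\<not> |?X| <o \<nu>" using h(2)[of ?X] by blast
      then have "\<nu> \<le>o |?X|" using co card_of_Card_order Card_order_not_less by blast
      moreover have "|?X| \<le>o |X|"
        using e(1) by (intro card_of_ordLeqI[of e]) (auto intro: inj_on_subset)
      ultimately show ?thesis using \<nu>(1) ordLess_ordLeq_trans by blast
    qed
    moreover have "(e \<circ> h) ` I \<subseteq> Field \<Lambda>" using h(1) e(2) by auto
    ultimately show ?thesis by blast
  qed
  then obtain f where "\<And>a. a \<in> A \<Longrightarrow> f a ` I \<subseteq> Field \<Lambda> \<and>
      (\<forall>X. eventually (\<lambda>i. i \<in> I \<and> f a i \<in> X) D \<longrightarrow> |underS \<Lambda> a| <o |X| )"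
    by metis
  then have "cofinal_decompositions I D \<Lambda> A f"
    using D \<Lambda> A by unfold_locales auto
  then show thesis using that by blast
qed

theorem theorem5p1:
  fixes I :: "'i set" and D :: "'i filter" and \<Lambda> :: "'a rel"
  assumes "ultrafilter_on I D"
    and "limit_cardinal \<Lambda>"
    and "\<And>\<nu>' :: 'a rel. Card_order \<nu>' \<Longrightarrow> \<nu>' <o \<Lambda> \<Longrightarrow>
           \<exists>\<nu> :: 'a rel. \<nu>' <o \<nu> \<and> \<nu> <o \<Lambda> \<and> decomposable I D \<nu>"
  shows "(\<exists>\<kappa> :: ('a \<Rightarrow> 'a) rel. decomposable I D \<kappa> \<and> \<Lambda> \<le>o \<kappa> \<and> \<kappa> \<le>o \<Lambda> ^c cf \<Lambda>) \<and>
    (\<forall>\<mu> :: 'm rel. \<not> regularCard \<Lambda> \<and> Cinfinite \<mu> \<and> regular_filter I D \<mu> (cf \<Lambda>) \<longrightarrow>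
      (\<exists>\<kappa> :: ('m \<Rightarrow> 'a) rel. decomposable I D \<kappa> \<and> \<Lambda> \<le>o \<kappa> \<and> \<kappa> \<le>o cexp_less \<Lambda> \<mu>) \<and>
      (\<forall>\<Lambda>' :: 'a rel. Card_order \<Lambda>' \<and> \<mu> \<le>o \<Lambda>' \<and> \<Lambda>' <o \<Lambda> \<longrightarrow>
        (\<exists>\<kappa> :: 'a set rel. decomposable I D \<kappa> \<and> \<Lambda> \<le>o \<kappa> \<and> \<kappa> \<le>o COV \<Lambda> \<Lambda>' \<mu>)))"
proof -
  have D: "D \<le> principal I" using assms(1) unfolding ultrafilter_on_def by blast
  have \<Lambda>: "Cinfinite \<Lambda>" using assms(2) unfolding limit_cardinal_def by blast
  obtain A where A: "cf \<Lambda> = |A|" "A \<subseteq> Field \<Lambda>" "cofinal A \<Lambda>" using cf_eq_card_of[OF \<Lambda>] .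
  obtain f where "cofinal_decompositions I D \<Lambda> A f"
    using cofinal_decompositions_exist[OF D \<Lambda> A(2,3) assms(3)] .
  then interpret cofinal_decompositions I D \<Lambda> A f .
  obtain \<kappa>0 :: "('a \<Rightarrow> 'a) rel"
    where \<kappa>0: "decomposable I D \<kappa>0" "\<Lambda> \<le>o \<kappa>0" "\<kappa>0 \<le>o \<Lambda> ^c cf \<Lambda>"
    using decomposable_power unfolding A(1) cexp_def Field_card_of by blast
  have small: "\<exists>\<kappa> :: ('m \<Rightarrow> 'a) rel. decomposable I D \<kappa> \<and> \<Lambda> \<le>o \<kappa> \<and> \<kappa> \<le>o cexp_less \<Lambda> \<mu>"
    if \<mu>: "\<not> regularCard \<Lambda>" "Cinfinite \<mu>" "regular_filter I D \<mu> (cf \<Lambda>)" for \<mu> :: "'m rel"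
  proof -
    have cf: "Card_order (cf \<Lambda>)" unfolding A(1) by (rule card_of_Card_order)
    show ?thesis
    proof (cases "cf \<Lambda> <o \<mu>")
      case True
      then have "\<Lambda> ^c cf \<Lambda> \<le>o cexp_less \<Lambda> \<mu>" using cexp_le_cexp_less \<Lambda> cf by blast
      then show ?thesis using decomposable_transfer[OF \<kappa>0(1,2)] \<kappa>0(3) ordLeq_transitive by blast
    next
      case False
      \<comment> \<open>Singularity gives \<open>cf \<Lambda> <o \<Lambda>\<close>, hence
        \<open>\<mu> <o \<Lambda>\<close>, so \<open>\<mu>\<close> itself can serve as the bound
        \<open>l\<close> on the covering sets.\<close>
      then have "\<mu> \<le>o cf \<Lambda>" using cf \<mu>(2) Card_order_not_less by blast
      then have less: "\<mu> <o \<Lambda>" using singular_cf_less[OF \<Lambda> \<mu>(1)] ordLeq_ordLess_trans by blast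
      obtain \<kappa> :: "'a set rel" where \<kappa>: "decomposable I D \<kappa>" "\<Lambda> \<le>o \<kappa>"
        "\<kappa> \<le>o |{Z. Z \<subseteq> Field \<Lambda> \<and> |Z| <o \<mu>}|"
        using decomposable_cover[of \<mu> \<mu> "{Z. Z \<subseteq> Field \<Lambda> \<and> |Z| <o \<mu>}"] \<mu>(2,3) A(1) less by auto
      then show ?thesis
        using decomposable_transfer[OF \<kappa>(1,2)] ordLeq_transitive
          card_of_small_subsets[OF \<Lambda> \<mu>(2) ordLess_imp_ordLeq[OF less]] by blast
    qed
  qed
  have cover: "\<exists>\<kappa> :: 'a set rel. decomposable I D \<kappa> \<and> \<Lambda> \<le>o \<kappa> \<and> \<kappa> \<le>o COV \<Lambda> \<Lambda>' \<mu>"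
    if \<mu>: "Cinfinite \<mu>" "regular_filter I D \<mu> (cf \<Lambda>)"
      and \<Lambda>': "Card_order \<Lambda>'" "\<mu> \<le>o \<Lambda>'" "\<Lambda>' <o \<Lambda>" for \<mu> :: "'m rel" and \<Lambda>' :: "'a rel"
  proof -
    obtain F where F: "COV \<Lambda> \<Lambda>' \<mu> = |F|" "\<And>Y. Y \<in> F \<Longrightarrow> Y \<subseteq> Field \<Lambda> \<and> |Y| <o \<Lambda>'"
      "\<And>Z. Z \<subseteq> Field \<Lambda> \<Longrightarrow> |Z| <o \<mu> \<Longrightarrow> \<exists>Y\<in>F. Z \<subseteq> Y"
      using COV_eq_card_of[OF \<Lambda>'(2), of \<Lambda>] by metis
    have "Cinfinite \<Lambda>'" using \<mu>(1) \<Lambda>'(1,2) cinfinite_mono by blast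
    then show ?thesis
      unfolding F(1) using \<mu>(2) \<Lambda>'(3) F(2,3) A(1) by (intro decomposable_cover[of \<mu> \<Lambda>']) auto
  qed
  show ?thesis using \<kappa>0 small cover by blast
qed

end
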